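(* Let $Y$ and $Z$ be real-valued random variables with finite supports $\{y_i\}_{i\in I}$ and $\{z_j\}_{j\in J}$, respectively. Then $Z\succeq_{icv} Y$ if and only if the optimal value of the linear program $$\min_{a,b,c}\ \sum_{j\in J} b_j \Pr[Z=z_j] - \sum_{i\in I} a_i \Pr[Y=y_i]$$ over $a\in\mathbb{R}^I$, $b\in\mathbb{R}^J$, $c\in\mathbb{R}^J$, subject to $$a_i \leq b_j + c_j (y_i-z_j)\quad \forall i\in I,\ j\in J,\qquad c_j\geq 0\quad \forall j\in J,$$ is greater than or equal to $0$.
   Context: $Z\succeq_{icv} Y$ (dominance in increasing concave stochastic order) means $\mathbb{E}[u(Z)]\geq\mathbb{E}[u(Y)]$ for all (weakly) increasing concave functions $u:\mathbb{R}\to\mathbb{R}$. The points $y_i$ ($i\in I$) are distinct, as are the points $z_j$ ($j\in J$), with $I,J$ finite index sets. An unbounded-below linear program has optimal value $-\infty$. *)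

theory Defs
  imports "HOL-Probability.Probability"
begin

text \<open>
  The relation \<open>Z \<succeq>\<^sub>i\<^sub>c\<^sub>v Y\<close>. It compares distributions only, so \<open>Z\<close> and \<open>Y\<close> may live on
  different probability spaces. The Bochner integral of a non-integrable function is \<open>0\<close>, so the
  definition is meant for variables with \<open>u \<circ> Z\<close> and \<open>u \<circ> Y\<close> integrable for every such \<open>u\<close>;
  variables with finite support have this property.
\<close>
definition icv_dominates ::
  "'b measure \<Rightarrow> ('b \<Rightarrow> real) \<Rightarrow> 'a measure \<Rightarrow> ('a \<Rightarrow> real) \<Rightarrow> bool" where
  "icv_dominates N Z M Y \<longleftrightarrow>
     (\<forall>u::real \<Rightarrow> real. mono u \<and> concave_on UNIV u \<longrightarrow>
        (\<integral>\<omega>. u (Z \<omega>) \<partial>N) \<ge> (\<integral>\<omega>. u (Y \<omega>) \<partial>M))"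

definition pr_eq :: "'a measure \<Rightarrow> ('a \<Rightarrow> real) \<Rightarrow> real \<Rightarrow> real" where
  "pr_eq M X x = measure M {\<omega> \<in> space M. X \<omega> = x}"

text \<open>Values outside \<open>S\<close> are allowed on a null set.\<close>
definition has_finite_support :: "'a measure \<Rightarrow> ('a \<Rightarrow> real) \<Rightarrow> real set \<Rightarrow> bool" where
  "has_finite_support M X S \<longleftrightarrow>
     finite S \<and> (\<forall>x\<in>S. pr_eq M X x > 0) \<and> (AE \<omega> in M. X \<omega> \<in> S)"

text \<open>Elements of \<open>\<real>\<^sup>I\<close> are extensional functions on \<open>I\<close>.\<close>
definition lp_feasible ::
  "'i set \<Rightarrow> ('i \<Rightarrow> real) \<Rightarrow> 'j set \<Rightarrow> ('j \<Rightarrow> real) \<Rightarrow>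
     (('i \<Rightarrow> real) \<times> ('j \<Rightarrow> real) \<times> ('j \<Rightarrow> real)) set" where
  "lp_feasible I y J z =
     {(a, b, c). a \<in> I \<rightarrow>\<^sub>E UNIV \<and> b \<in> J \<rightarrow>\<^sub>E UNIV \<and> c \<in> J \<rightarrow>\<^sub>E UNIV \<and>
        (\<forall>i\<in>I. \<forall>j\<in>J. a i \<le> b j + c j * (y i - z j)) \<and> (\<forall>j\<in>J. c j \<ge> 0)}"

text \<open>
  Optimal value of the minimisation, as an extended real: \<open>-\<infinity>\<close> if the program is unbounded below.
\<close>
definition lp_value ::
  "'a measure \<Rightarrow> ('a \<Rightarrow> real) \<Rightarrow> 'i set \<Rightarrow> ('i \<Rightarrow> real) \<Rightarrow>
   'b measure \<Rightarrow> ('b \<Rightarrow> real) \<Rightarrow> 'j set \<Rightarrow> ('j \<Rightarrow> real) \<Rightarrow> ereal" where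
  "lp_value M Y I y N Z J z =
     (INF (a, b, c) \<in> lp_feasible I y J z.
        ereal ((\<Sum>j\<in>J. b j * pr_eq N Z (z j)) - (\<Sum>i\<in>I. a i * pr_eq M Y (y i))))"

end

theory Submission
  imports Defs
begin

text \<open>
  An increasing concave function on the line is the pointwise minimum of its tangents, all of
  nonnegative slope, and the linear program is a finite shadow of this fact. Write \<open>\<E>\<close> for
  expectation; for finitely supported variables it is a weighted sum over the support
  (\<open>integral_finite_support\<close>), so the objective of the program is
  \<open>\<Sum>j. b j * Pr (Z = z j) - \<Sum>i. a i * Pr (Y = y i)\<close>, which becomes \<open>\<E> (u Z) - \<E> (u Y)\<close> as soon
  as \<open>b\<close> and \<open>a\<close> are the values of one function \<open>u\<close> at the support points.

  If dominance holds and \<open>(a, b, c)\<close> is feasible, take for \<open>u\<close> the lower envelope of the lines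
  through \<open>(z j, b j)\<close> with slope \<open>c j\<close>. It is increasing and concave
  (\<open>mono_lower_envelope\<close>, \<open>concave_on_lower_envelope\<close>), lies below \<open>b j\<close> at \<open>z j\<close> and, by
  feasibility, above \<open>a i\<close> at \<open>y i\<close>. Hence the objective is at least \<open>\<E> (u Z) - \<E> (u Y) \<ge> 0\<close>.

  Conversely, for a given increasing concave \<open>u\<close>, the values \<open>a i = u (y i)\<close> and \<open>b j = u (z j)\<close>
  together with supergradients \<open>c j\<close> of \<open>u\<close> at \<open>z j\<close> (\<open>mono_concave_supergradient\<close>) form a feasible
  point whose objective is exactly \<open>\<E> (u Z) - \<E> (u Y)\<close>; a nonnegative optimal value makes it
  nonnegative.
\<close>

text \<open>
  Almost surely \<open>u (X \<omega>)\<close> is a combination of indicators of the events \<open>X = x s\<close>; injectivity of the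
  parametrisation ensures that no support point is counted twice.
\<close>
lemma integral_finite_support:
  fixes X :: "'a \<Rightarrow> real" and x :: "'s \<Rightarrow> real" and u :: "real \<Rightarrow> real"
  assumes "prob_space M" and X[measurable]: "X \<in> borel_measurable M"
    and S: "finite S" and inj: "inj_on x S"
    and supp: "has_finite_support M X (x ` S)"
    and u[measurable]: "u \<in> borel_measurable borel"
  shows "(\<integral>\<omega>. u (X \<omega>) \<partial>M) = (\<Sum>s\<in>S. u (x s) * pr_eq M X (x s))"
proof -
  interpret prob_space M by fact
  let ?E = "\<lambda>s. {\<omega> \<in> space M. X \<omega> = x s}"
  have "(\<integral>\<omega>. u (X \<omega>) \<partial>M) = (\<integral>\<omega>. (\<Sum>s\<in>S. u (x s) * indicator (?E s) \<omega>) \<partial>M)"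
  proof (rule integral_cong_AE)
    have "AE \<omega> in M. X \<omega> \<in> x ` S"
      using supp by (simp add: has_finite_support_def)
    then show "AE \<omega> in M. u (X \<omega>) = (\<Sum>s\<in>S. u (x s) * indicator (?E s) \<omega>)"
    proof (rule AE_mp, intro AE_I2 impI)
      fix \<omega> assume \<omega>: "\<omega> \<in> space M" "X \<omega> \<in> x ` S"
      then obtain t where t: "t \<in> S" "X \<omega> = x t" by blast
      have "(\<Sum>s\<in>S. u (x s) * indicator (?E s) \<omega>) = (\<Sum>s\<in>S. if s = t then u (x t) else 0)"
        using \<omega>(1) t inj by (intro sum.cong) (auto simp: indicator_def inj_on_eq_iff)
      then show "u (X \<omega>) = (\<Sum>s\<in>S. u (x s) * indicator (?E s) \<omega>)"
        using S t by simp
    qed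
  qed measurable
  also have "\<dots> = (\<Sum>s\<in>S. u (x s) * measure M (?E s))"
    by (subst Bochner_Integration.integral_sum) (auto simp: emeasure_eq_measure)
  finally show ?thesis by (simp add: pr_eq_def)
qed

lemma finite_support_nonempty:
  assumes "prob_space M" "has_finite_support M X S"
  shows "S \<noteq> {}"
  using prob_space.AE_False[OF assms(1)] assms(2) by (auto simp: has_finite_support_def)

lemma mono_lower_envelope:
  fixes b c z :: "'j \<Rightarrow> real"
  assumes "finite J" "J \<noteq> {}" "\<And>j. j \<in> J \<Longrightarrow> c j \<ge> 0"
  shows "mono (\<lambda>x. Min ((\<lambda>j. b j + c j * (x - z j)) ` J))"
proof (rule monoI)
  fix s t :: real assume "s \<le> t"
  have "Min ((\<lambda>j. b j + c j * (s - z j)) ` J) \<le> b j + c j * (t - z j)" if "j \<in> J" for j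
  proof -
    have "Min ((\<lambda>j. b j + c j * (s - z j)) ` J) \<le> b j + c j * (s - z j)"
      using assms(1) that by simp
    also have "\<dots> \<le> b j + c j * (t - z j)"
      using assms(3)[OF that] \<open>s \<le> t\<close> by (simp add: mult_left_mono)
    finally show ?thesis .
  qed
  then show "Min ((\<lambda>j. b j + c j * (s - z j)) ` J) \<le> Min ((\<lambda>j. b j + c j * (t - z j)) ` J)"
    using assms(1,2) by simp
qed

lemma concave_on_lower_envelope:
  fixes b c z :: "'j \<Rightarrow> real"
  assumes "finite J" "J \<noteq> {}"
  shows "concave_on UNIV (\<lambda>x. Min ((\<lambda>j. b j + c j * (x - z j)) ` J))" (is "concave_on _ ?u")
  unfolding concave_on_iff
proof (intro conjI ballI allI impI)
  fix s t p q :: real assume pq: "0 \<le> p" "0 \<le> q" "p + q = 1"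
  have below: "?u r \<le> b j + c j * (r - z j)" if "j \<in> J" for r j
    using assms(1) that by simp
  have "p * ?u s + q * ?u t \<le> b j + c j * (p * s + q * t - z j)" if "j \<in> J" for j
  proof -
    have "p * ?u s + q * ?u t
        \<le> p * (b j + c j * (s - z j)) + q * (b j + c j * (t - z j))"
      using pq(1,2) below[OF that] by (intro add_mono mult_left_mono) auto
    also have "\<dots> = (p + q) * (b j - c j * z j) + c j * (p * s + q * t)"
      by (simp add: algebra_simps)
    also have "\<dots> = b j + c j * (p * s + q * t - z j)"
      using pq(3) by (simp add: algebra_simps)
    finally show ?thesis .
  qed
  then show "p * ?u s + q * ?u t \<le> ?u (p *\<^sub>R s + q *\<^sub>R t)"
    using assms by simp
qed simp

text \<open>
  Any supergradient will do: the value one unit to the right of \<open>x\<close> is at least \<open>u x\<close> by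
  monotonicity and at most \<open>u x + c\<close> by the tangent inequality, which forces \<open>c \<ge> 0\<close>.
\<close>
lemma mono_concave_supergradient:
  fixes u :: "real \<Rightarrow> real"
  assumes "mono u" and "concave_on UNIV u"
  obtains c where "c \<ge> 0" and "\<And>t. u t \<le> u x + c * (t - x)"
proof -
  define d where "d = Inf ((\<lambda>t. (- u x - - u t) / (x - t)) ` ({x<..} \<inter> UNIV))"
  have tangent: "u t \<le> u x + (- d) * (t - x)" for t
    using convex_le_Inf_differential[of UNIV "\<lambda>t. - u t" x t] assms(2)
    by (simp add: concave_on_def d_def)
  have "u x \<le> u (x + 1)"
    using assms(1) by (simp add: mono_def)
  with tangent[of "x + 1"] have "- d \<ge> 0" by simp
  with tangent show ?thesis using that by blast
qed

theorem mainTheorem2: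
  fixes M :: "'a measure" and N :: "'b measure"
    and Y :: "'a \<Rightarrow> real" and Z :: "'b \<Rightarrow> real"
    and I :: "'i set" and J :: "'j set"
    and y :: "'i \<Rightarrow> real" and z :: "'j \<Rightarrow> real"
  assumes "prob_space M" and "prob_space N"
    and "Y \<in> borel_measurable M" and "Z \<in> borel_measurable N"
    and "finite I" and "finite J"
    and "inj_on y I" and "inj_on z J"
    and "has_finite_support M Y (y ` I)"
    and "has_finite_support N Z (z ` J)"
  shows "icv_dominates N Z M Y \<longleftrightarrow> lp_value M Y I y N Z J z \<ge> 0"
proof
  interpret M: prob_space M by fact
  interpret N: prob_space N by fact
  have EY: "(\<integral>\<omega>. u (Y \<omega>) \<partial>M) = (\<Sum>i\<in>I. u (y i) * pr_eq M Y (y i))" if "mono u" for u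
    using integral_finite_support[OF assms(1,3,5,7,9)] borel_measurable_mono[OF that] by blast
  have EZ: "(\<integral>\<omega>. u (Z \<omega>) \<partial>N) = (\<Sum>j\<in>J. u (z j) * pr_eq N Z (z j))" if "mono u" for u
    using integral_finite_support[OF assms(2,4,6,8,10)] borel_measurable_mono[OF that] by blast
  have J: "J \<noteq> {}"
    using finite_support_nonempty[OF assms(2,10)] by simp
  {
    assume dom: "icv_dominates N Z M Y"
    have "0 \<le> (\<Sum>j\<in>J. b j * pr_eq N Z (z j)) - (\<Sum>i\<in>I. a i * pr_eq M Y (y i))"
      if feas: "(a, b, c) \<in> lp_feasible I y J z" for a b c
    proof -
      from feas have le: "\<And>i j. i \<in> I \<Longrightarrow> j \<in> J \<Longrightarrow> a i \<le> b j + c j * (y i - z j)"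
        and c: "\<And>j. j \<in> J \<Longrightarrow> c j \<ge> 0"
        by (auto simp: lp_feasible_def)
      define u where "u = (\<lambda>x. Min ((\<lambda>j. b j + c j * (x - z j)) ` J))"
      have u: "mono u" "concave_on UNIV u"
        unfolding u_def using assms(6) J c
        by (simp_all add: mono_lower_envelope concave_on_lower_envelope)
      have uz: "u (z j) \<le> b j" if "j \<in> J" for j
      proof -
        have "u (z j) \<le> b j + c j * (z j - z j)"
          unfolding u_def by (rule Min_le[OF finite_imageI[OF assms(6)] imageI[OF that]])
        then show ?thesis by simp
      qed
      have uy: "a i \<le> u (y i)" if "i \<in> I" for i
        unfolding u_def using assms(6) J le that by simp
      have "(\<Sum>i\<in>I. a i * pr_eq M Y (y i)) \<le> (\<integral>\<omega>. u (Y \<omega>) \<partial>M)"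
        unfolding EY[OF u(1)] using uy by (intro sum_mono mult_right_mono) (auto simp: pr_eq_def)
      also have "\<dots> \<le> (\<integral>\<omega>. u (Z \<omega>) \<partial>N)"
        using dom u by (simp add: icv_dominates_def)
      also have "\<dots> \<le> (\<Sum>j\<in>J. b j * pr_eq N Z (z j))"
        unfolding EZ[OF u(1)] using uz by (intro sum_mono mult_right_mono) (auto simp: pr_eq_def)
      finally show ?thesis by simp
    qed
    then show "lp_value M Y I y N Z J z \<ge> 0"
      unfolding lp_value_def by (intro INF_greatest) auto
  }
  assume val: "lp_value M Y I y N Z J z \<ge> 0"
  show "icv_dominates N Z M Y"
    unfolding icv_dominates_def
  proof (intro allI impI)
    fix u :: "real \<Rightarrow> real" assume u: "mono u \<and> concave_on UNIV u"
    then have "\<exists>c\<ge>0. \<forall>t. u t \<le> u x + c * (t - x)" for x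
      using mono_concave_supergradient[of u x] by blast
    then obtain g where g: "g x \<ge> 0" "u t \<le> u x + g x * (t - x)" for x t
      by metis
    let ?a = "\<lambda>i\<in>I. u (y i)" and ?b = "\<lambda>j\<in>J. u (z j)" and ?c = "\<lambda>j\<in>J. g (z j)"
    have "(?a, ?b, ?c) \<in> lp_feasible I y J z"
      using g by (auto simp: lp_feasible_def)
    then have "lp_value M Y I y N Z J z
        \<le> ereal ((\<Sum>j\<in>J. ?b j * pr_eq N Z (z j)) - (\<Sum>i\<in>I. ?a i * pr_eq M Y (y i)))"
      unfolding lp_value_def by (rule INF_lower2) simp
    also have "\<dots> = ereal ((\<integral>\<omega>. u (Z \<omega>) \<partial>N) - (\<integral>\<omega>. u (Y \<omega>) \<partial>M))"
      using u by (simp add: EY EZ)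
    finally have "0 \<le> ereal ((\<integral>\<omega>. u (Z \<omega>) \<partial>N) - (\<integral>\<omega>. u (Y \<omega>) \<partial>M))"
      by (rule order_trans[OF val])
    then show "(\<integral>\<omega>. u (Z \<omega>) \<partial>N) \<ge> (\<integral>\<omega>. u (Y \<omega>) \<partial>M)"
      by simp
  qed
qed

end
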